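(* Let $J_T$ be an arbitrary period-$T$ Jacobi operator and $\{\lambda_i\}_{i=1}^\infty$ a sequence of numbers belonging to $\sigma_{ell}(J_T)$ such that every finite collection $\{\pi,\theta(\lambda_1),\theta(\lambda_2),\dots,\theta(\lambda_k)\}$, $k\ge 1$, is rationally independent. Then for any positive sequence $K(n)$ with $K(n)\to\infty$ (arbitrarily slowly) as $n\to\infty$, there exist a real sequence (potential) $(q_n)_{n\ge1}$ with $|q_n|\leq\frac{K(n)}{n}$ for all $n$, and, for every $i\geq 1$, a non-zero vector $(u_{n,i})_{n\geq 1}\in l^2(\mathbb{N};\mathbb{R})$, such that $$(J_T+Q)(u_{n,i})_{n\geq 1}=\lambda_i(u_{n,i})_{n\geq 1}\quad\text{for all } i\ge 1,$$ where $Q$ is the infinite diagonal matrix with entries $(q_n)$.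
   Context: A period-$T$ Jacobi operator $J_T$ ($T\in\mathbb{N}$) is the operator on $l^2(\mathbb{N})$ given by the tridiagonal symmetric matrix with diagonal entries $b_1,b_2,\dots$ and off-diagonal entries $a_1,a_2,\dots$, where $(a_n)$ and $(b_n)$ are $T$-periodic, $a_n,b_n\in\mathbb{R}$ and $a_n>0$; that is, $(J_Tu)_1=b_1u_1+a_1u_2$ and $(J_Tu)_n=a_{n-1}u_{n-1}+b_nu_n+a_nu_{n+1}$ for $n\ge 2$. The transfer matrices are $$B_i(\lambda)=\begin{pmatrix}0&1\\-\frac{a_{i-1}}{a_i}&\frac{\lambda-b_i}{a_i}\end{pmatrix},\quad i\in\{1,\dots,T\},\ a_0:=a_T,$$ and the monodromy matrix is $M(\lambda)=B_T(\lambda)\cdots B_1(\lambda)$. The generalised interior of the essential spectrum is $\sigma_{ell}(J_T)=\{\lambda\in\mathbb{R} : |\operatorname{Tr}M(\lambda)|<2\}$. For $\lambda\in\sigma_{ell}(J_T)$ the eigenvalues of $M(\lambda)$ are $e^{\pm i\theta(\lambda)}$ with $\theta(\lambda)\in(0,\pi)$; $\theta(\lambda)$ is called the quasi-momentum. A finite collection of real numbers is rationally independent if it is linearly independent over $\mathbb{Q}$. *)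

theory Defs
  imports "HOL-Analysis.Analysis"
begin

text \<open>Sequences indexed by the positive integers are functions on \<^typ>\<open>nat\<close> of which only the values
  at arguments \<open>n \<ge> 1\<close> are relevant; the value at \<open>0\<close> is arbitrary and never used.\<close>

definition period_jacobi :: "nat \<Rightarrow> (nat \<Rightarrow> real) \<Rightarrow> (nat \<Rightarrow> real) \<Rightarrow> bool" where
  "period_jacobi T a b \<longleftrightarrow> T \<ge> 1 \<and>
     (\<forall>n\<ge>1. a n > 0 \<and> a (n + T) = a n \<and> b (n + T) = b n)"

definition jacobi_op :: "(nat \<Rightarrow> real) \<Rightarrow> (nat \<Rightarrow> real) \<Rightarrow> (nat \<Rightarrow> real) \<Rightarrow> nat \<Rightarrow> real" where
  "jacobi_op a b u n =
     (if n = 1 then b 1 * u 1 + a 1 * u 2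
      else a (n - 1) * u (n - 1) + b n * u n + a n * u (n + 1))"

definition diag_op :: "(nat \<Rightarrow> real) \<Rightarrow> (nat \<Rightarrow> real) \<Rightarrow> nat \<Rightarrow> real" where
  "diag_op q u n = q n * u n"

definition l2_real :: "(nat \<Rightarrow> real) set" where
  "l2_real = {u. (\<lambda>n. (u n)\<^sup>2) summable_on {1..}}"

text \<open>The conditional implements the convention \<open>a\<^sub>0 := a\<^sub>T\<close>.\<close>

definition transfer_matrix ::
    "nat \<Rightarrow> (nat \<Rightarrow> real) \<Rightarrow> (nat \<Rightarrow> real) \<Rightarrow> real \<Rightarrow> nat \<Rightarrow> real^2^2" where
  "transfer_matrix T a b x i =
     vector [vector [0, 1],
             vector [- (if i = 1 then a T else a (i - 1)) / a i, (x - b i) / a i]]"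

primrec transfer_product ::
    "nat \<Rightarrow> (nat \<Rightarrow> real) \<Rightarrow> (nat \<Rightarrow> real) \<Rightarrow> real \<Rightarrow> nat \<Rightarrow> real^2^2" where
  "transfer_product T a b x 0 = mat 1"
| "transfer_product T a b x (Suc n) =
     transfer_matrix T a b x (Suc n) ** transfer_product T a b x n"

definition monodromy :: "nat \<Rightarrow> (nat \<Rightarrow> real) \<Rightarrow> (nat \<Rightarrow> real) \<Rightarrow> real \<Rightarrow> real^2^2" where
  "monodromy T a b x = transfer_product T a b x T"

definition sigma_ell :: "nat \<Rightarrow> (nat \<Rightarrow> real) \<Rightarrow> (nat \<Rightarrow> real) \<Rightarrow> real set" where
  "sigma_ell T a b = {x. \<bar>trace (monodromy T a b x)\<bar> < 2}"

definition complex_eigenvalues :: "real^'n^'n \<Rightarrow> complex set" where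
  "complex_eigenvalues A =
     {z. \<exists>v :: complex^'n. v \<noteq> 0 \<and> (\<chi> i j. complex_of_real (A $ i $ j)) *v v = z *s v}"

text \<open>The description determines a unique number for \<open>x \<in> sigma_ell T a b\<close>; see the lemma
  \<open>quasi_momentum\<close> below.\<close>

definition quasi_momentum :: "nat \<Rightarrow> (nat \<Rightarrow> real) \<Rightarrow> (nat \<Rightarrow> real) \<Rightarrow> real \<Rightarrow> real" where
  "quasi_momentum T a b x =
     (THE t. 0 < t \<and> t < pi \<and>
        complex_eigenvalues (monodromy T a b x) = {exp (\<i> * of_real t), exp (- \<i> * of_real t)})"

text \<open>Rational independence of a collection is that of the indexed family \<open>x\<close> over \<open>I\<close>, so repeated
  entries make it dependent.  This is why injectivity is required in addition to independence of the
  set of values.\<close>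

definition rationally_independent :: "'i set \<Rightarrow> ('i \<Rightarrow> real) \<Rightarrow> bool" where
  "rationally_independent I x \<longleftrightarrow>
     inj_on x I \<and> module.independent (\<lambda>(r::rat) y. of_rat r * y) (x ` I)"

lemma vector_space_rat_real: "vector_space (\<lambda>(r::rat) (y::real). of_rat r * y)"
  by unfold_locales (auto simp: algebra_simps of_rat_add of_rat_mult)

lemma rationally_independent_iff:
  assumes "finite I"
  shows "rationally_independent I x \<longleftrightarrow>
    (\<forall>c :: 'i \<Rightarrow> rat. (\<Sum>i\<in>I. of_rat (c i) * x i) = 0 \<longrightarrow> (\<forall>i\<in>I. c i = 0))"
proof -
  interpret vector_space "\<lambda>(r::rat) (y::real). of_rat r * y" by (rule vector_space_rat_real)
  show ?thesis
  proof
    assume "rationally_independent I x"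
    then have inj: "inj_on x I" and ind: "independent (x ` I)"
      by (auto simp: rationally_independent_def)
    show "\<forall>c :: 'i \<Rightarrow> rat. (\<Sum>i\<in>I. of_rat (c i) * x i) = 0 \<longrightarrow> (\<forall>i\<in>I. c i = 0)"
    proof (intro allI impI ballI)
      fix c :: "'i \<Rightarrow> rat" and i
      assume s: "(\<Sum>i\<in>I. of_rat (c i) * x i) = 0" and i: "i \<in> I"
      have "(\<Sum>y\<in>x ` I. of_rat (c (the_inv_into I x y)) * y) = 0"
        using s by (simp add: sum.reindex[OF inj] the_inv_into_f_f[OF inj])
      from independentD[OF ind _ _ this, of "x i"] assms i
      show "c i = 0" by (simp add: the_inv_into_f_f[OF inj])
    qed
  next
    assume h: "\<forall>c :: 'i \<Rightarrow> rat. (\<Sum>i\<in>I. of_rat (c i) * x i) = 0 \<longrightarrow> (\<forall>i\<in>I. c i = 0)"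
    have inj: "inj_on x I"
    proof (rule inj_onI, rule ccontr)
      fix i j assume ij: "i \<in> I" "j \<in> I" "x i = x j" "i \<noteq> j"
      define c :: "'i \<Rightarrow> rat" where "c k = (if k = i then 1 else if k = j then -1 else 0)" for k
      have "(\<Sum>k\<in>I. of_rat (c k) * x k) = (\<Sum>k\<in>{i, j}. of_rat (c k) * x k)"
        using assms ij by (intro sum.mono_neutral_right) (auto simp: c_def)
      also have "\<dots> = 0" using ij by (simp add: c_def)
      finally have "c i = 0" using h ij by blast
      then show False by (simp add: c_def)
    qed
    have "independent (x ` I)"
    proof (rule independent_if_scalars_zero)
      show "finite (x ` I)" using assms by simp
      fix f :: "real \<Rightarrow> rat" and y
      assume s: "(\<Sum>y\<in>x ` I. of_rat (f y) * y) = 0" and y: "y \<in> x ` I"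
      have "(\<Sum>i\<in>I. of_rat (f (x i)) * x i) = 0"
        using s by (simp add: sum.reindex[OF inj])
      then show "f y = 0" using h[rule_format, of "\<lambda>i. f (x i)"] y by auto
    qed
    with inj show "rationally_independent I x" by (simp add: rationally_independent_def)
  qed
qed

lemma det_monodromy:
  assumes "period_jacobi T a b"
  shows "det (monodromy T a b x) = 1"
proof -
  have pos: "\<And>n. n \<ge> 1 \<Longrightarrow> a n > 0" and T: "T \<ge> 1"
    using assms by (auto simp: period_jacobi_def)
  have d: "det (transfer_product T a b x (Suc n)) = a T / a (Suc n)" for n
  proof (induction n)
    case 0
    then show ?case by (simp add: det_2 transfer_matrix_def)
  next
    case (Suc n)
    have "det (transfer_matrix T a b x (Suc (Suc n))) = a (Suc n) / a (Suc (Suc n))"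
      by (simp add: det_2 transfer_matrix_def)
    with Suc pos[of "Suc n"] show ?case
      by (simp add: det_mul del: transfer_product.simps(2)
          add: transfer_product.simps(2)[of T a b x "Suc n"])
  qed
  from d[of "T - 1"] T pos[of T] show ?thesis by (simp add: monodromy_def)
qed

lemma complex_eigenvalues_2:
  fixes A :: "real^2^2"
  shows "z \<in> complex_eigenvalues A \<longleftrightarrow> z\<^sup>2 - of_real (trace A) * z + of_real (det A) = 0"
proof -
  define C :: "complex^2^2" where "C = (\<chi> i j. complex_of_real (A $ i $ j))"
  have "z \<in> complex_eigenvalues A \<longleftrightarrow> (\<exists>v. v \<noteq> 0 \<and> (C - mat z) *v v = 0)"
    by (auto simp: complex_eigenvalues_def C_def vec_eq_iff matrix_vector_mult_def sum_2 forall_2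
        mat_def algebra_simps)
  also have "\<dots> \<longleftrightarrow> \<not> (\<exists>B. B ** (C - mat z) = mat 1)"
    by (auto simp: matrix_left_invertible_ker)
  also have "\<dots> \<longleftrightarrow> det (C - mat z) = 0"
    by (metis invertible_det_nz invertible_left_inverse)
  also have "det (C - mat z) = z\<^sup>2 - of_real (trace A) * z + of_real (det A)"
    by (simp add: det_2 C_def mat_def trace_def sum_2 power2_eq_square algebra_simps)
  finally show ?thesis .
qed

lemma quasi_momentum:
  assumes "period_jacobi T a b" and "x \<in> sigma_ell T a b"
  shows "quasi_momentum T a b x \<in> {0<..<pi}" (is ?A)
    and "complex_eigenvalues (monodromy T a b x) =
      {exp (\<i> * of_real (quasi_momentum T a b x)), exp (- \<i> * of_real (quasi_momentum T a b x))}"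
      (is ?B)
    and "2 * cos (quasi_momentum T a b x) = trace (monodromy T a b x)" (is ?C)
proof -
  let ?M = "monodromy T a b x"
  let ?P = "\<lambda>t. 0 < t \<and> t < pi \<and>
        complex_eigenvalues ?M = {exp (\<i> * of_real t), exp (- \<i> * of_real t)}"
  have fac: "z\<^sup>2 - of_real (2 * cos t) * z + 1 = (z - exp (\<i> * of_real t)) * (z - exp (- \<i> * of_real t))"
    for z and t :: real
  proof -
    have "exp (\<i> * of_real t) * exp (- \<i> * of_real t) = 1"
      by (simp flip: exp_add)
    moreover have "exp (\<i> * of_real t) + exp (- \<i> * of_real t) = of_real (2 * cos t)"
      by (simp add: complex_eq_iff Re_exp Im_exp)
    ultimately show ?thesis by (simp add: algebra_simps power2_eq_square) (metis distrib_left)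
  qed
  have ev: "z \<in> complex_eigenvalues ?M \<longleftrightarrow> z\<^sup>2 - of_real (trace ?M) * z + 1 = 0" for z
    by (simp add: complex_eigenvalues_2 det_monodromy[OF assms(1)])
  define t where "t = arccos (trace ?M / 2)"
  have tr: "-1 < trace ?M / 2" "trace ?M / 2 < 1"
    using assms(2) by (auto simp: sigma_ell_def)
  have t: "0 < t" "t < pi" "2 * cos t = trace ?M"
    using arccos_lt_bounded[of "trace ?M / 2"] tr by (auto simp: t_def cos_arccos)
  have Pt: "?P t"
    using t fac[of _ t] by (auto simp: ev simp flip: t(3))
  have uniq: "s = t" if "?P s" for s
  proof -
    have "exp (\<i> * of_real s) \<in> {exp (\<i> * of_real t), exp (- \<i> * of_real t)}"
      using that Pt by auto
    moreover have "Re (exp (\<i> * of_real t)) = cos t" "Re (exp (- \<i> * of_real t)) = cos t"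
      by (simp_all add: Re_exp)
    ultimately have "Re (exp (\<i> * of_real s)) = cos t" by force
    then have "cos s = cos t" by (simp add: Re_exp)
    then show ?thesis using that t cos_inj_pi[of s t] by simp
  qed
  have "quasi_momentum T a b x = t"
    unfolding quasi_momentum_def using Pt uniq by (rule the_equality)
  with Pt t show ?A ?B ?C by auto
qed

end

theory Submission
  imports Defs
begin

text \<open>The potential is supported on the first site of each period. Its value \<open>p\<close> at site
  \<open>k * T + 1\<close> acts on a solution by the shear \<open>u (k * T) \<mapsto> u (k * T) + p / a T * u (k * T + 1)\<close> before
  the monodromy matrix is applied. At an energy of \<open>sigma_ell\<close> the monodromy matrix is conjugate to a
  rotation: a left eigenvector gives a complex coordinate \<open>z\<close> of the pair
  \<open>(u (k * T), u (k * T + 1))\<close> in which one period reads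

    \<open>z \<mapsto> cis \<theta> * (z + p * c * Im z)\<close>

  with \<open>\<theta>\<close> the quasi-momentum and \<open>c \<noteq> 0\<close> a real constant (lemma \<open>elliptic_solution_dynamics\<close>).
  A small \<open>p > 0\<close> shrinks \<open>\<bar>z\<bar>\<^sup>2\<close> at least by a factor \<open>1 - p * \<bar>c\<bar> / 4\<close> whenever \<open>Arg z\<close> lies, modulo \<open>\<pi>\<close>, in
  an arc depending only on the sign of \<open>c\<close> (lemmas \<open>kick_contracts\<close> and \<open>shrinks_near_target\<close>).

  The strategy is to act only when this happens for the first \<open>j\<close> energies at once: \<open>p\<close> is
  a constant multiple of \<open>1 / k\<close> if all their coordinates lie in their arcs, and \<open>0\<close> otherwise. None of these
  \<open>j\<close> coordinates then grows in modulus. In a stretch without kick all coordinates rotate exactly, so rational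
  independence and Kronecker's theorem, made uniform in the initial angles by compactness of the torus,
  bound the waiting time by some \<open>L j\<close> (lemma \<open>rotation_reaches_shrinking\<close>). Hence every window of
  \<open>L j\<close> periods contains a kick, and with a multiple of \<open>1 / k\<close> that is large compared with \<open>L j\<close>
  the quantity \<open>k\<^sup>2 * \<bar>z\<bar>\<^sup>2\<close> does not increase from one window to the next. The multiple
  grows with \<open>j\<close>, but since \<open>K n \<rightarrow> \<infinity>\<close> it is admissible for all late times, so \<open>j\<close> may tend to
  infinity slowly enough (lemma \<open>level_schedule\<close>). Each energy is eventually among the first \<open>j\<close>,
  so each solution is \<open>O(1 / n)\<close> and lies in \<open>l\<^sup>2\<close> (theorem \<open>common_decay\<close>). No condition is to
  be met at the origin: the solution with \<open>u 0 = 0\<close>, \<open>u 1 = 1\<close> satisfies the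
  boundary equation whatever the potential is.\<close>

section \<open>Kronecker's theorem, uniformly in the target\<close>

text \<open>Kronecker's theorem for the numbers \<open>1, \<theta> 1 / \<pi>, \<dots>, \<theta> j / \<pi>\<close>; an integer relation among them is a
  rational relation among \<open>\<pi>, \<theta> 1, \<dots>, \<theta> j\<close>.\<close>

lemma kronecker_mod_pi:
  fixes \<theta> \<alpha> :: "nat \<Rightarrow> real"
  assumes ind: "rationally_independent {0..j} (\<lambda>i. if i = 0 then pi else \<theta> i)"
    and "\<epsilon> > 0"
  obtains k :: int and m :: "nat \<Rightarrow> int"
  where "\<And>i. i \<in> {1..j} \<Longrightarrow> \<bar>of_int k * (\<theta> i / pi) - of_int (m i) - \<alpha> i\<bar> < \<epsilon>"
proof -
  interpret Modules.module "\<lambda>(r::int) (x::real). of_int r * x"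
    by (simp add: Modules.module.intro distrib_left mult.commute)
  \<comment> \<open>\<open>Kronecker_thm_2\<close> expects the constant \<open>1\<close> in the last place.\<close>
  define \<psi> where "\<psi> i = (if i = j then 1 else \<theta> (Suc i) / pi)" for i
  have scalars: "\<forall>i\<le>j. c i = 0" if "(\<Sum>i\<le>j. of_int (c i) * \<psi> i) = 0" for c :: "nat \<Rightarrow> int"
  proof -
    define d :: "nat \<Rightarrow> rat" where "d i = of_int (if i = 0 then c j else c (i - 1))" for i
    have "0 = pi * (\<Sum>i\<le>j. of_int (c i) * \<psi> i)"
      using that by simp
    also have "(\<Sum>i\<le>j. of_int (c i) * \<psi> i) = of_int (c j) + (\<Sum>i<j. of_int (c i) * \<psi> i)"
      by (simp add: \<psi>_def flip: lessThan_Suc_atMost)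
    also have "pi * \<dots> = of_int (c j) * pi + (\<Sum>i<j. of_int (c i) * \<theta> (Suc i))"
      by (simp add: \<psi>_def distrib_left sum_distrib_left)
    also have "\<dots> = (\<Sum>i\<in>{0..j}. of_rat (d i) * (if i = 0 then pi else \<theta> i))"
      by (simp add: sum.atLeast_Suc_atMost[of 0] sum.shift_bounds_Suc_ivl
          sum.atLeast1_atMost_eq d_def)
    finally have "\<forall>i\<in>{0..j}. d i = 0"
      using ind unfolding rationally_independent_iff[OF finite_atLeastAtMost]
      by (metis (no_types, lifting))
    then have *: "\<And>i. i \<le> j \<Longrightarrow> d i = 0" by simp
    show ?thesis
    proof (intro allI impI)
      fix i assume "i \<le> j"
      then show "c i = 0" using *[of 0] *[of "Suc i"] by (cases "i = j") (auto simp: d_def)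
    qed
  qed
  have inj: "inj_on \<psi> {..j}"
  proof (rule inj_onI, rule ccontr)
    fix x y assume xy: "x \<in> {..j}" "y \<in> {..j}" "\<psi> x = \<psi> y" "x \<noteq> y"
    define c :: "nat \<Rightarrow> int" where "c i = (if i = x then 1 else if i = y then -1 else 0)" for i
    have "(\<Sum>i\<le>j. of_int (c i) * \<psi> i) = (\<Sum>i\<in>{x, y}. of_int (c i) * \<psi> i)"
      using xy by (intro sum.mono_neutral_right) (auto simp: c_def)
    also have "\<dots> = 0" using xy by (simp add: c_def)
    finally show False using scalars[of c] xy by (auto simp: c_def)
  qed
  have "independent (\<psi> ` {..j})"
    unfolding dependent_finite[OF finite_imageI[OF finite_atMost]]
  proof (rule notI, elim exE bexE conjE)
    fix f :: "real \<Rightarrow> int" and y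
    assume s: "(\<Sum>y\<in>\<psi> ` {..j}. of_int (f y) * y) = 0" and y: "y \<in> \<psi> ` {..j}" "f y \<noteq> 0"
    have "(\<Sum>i\<le>j. of_int (f (\<psi> i)) * \<psi> i) = 0"
      using s by (simp add: sum.reindex[OF inj])
    with y show False using scalars[of "\<lambda>i. f (\<psi> i)"] by auto
  qed
  from Kronecker_thm_2[OF this inj _ \<open>\<epsilon> > 0\<close>, of "\<lambda>i. \<alpha> (Suc i)"]
  obtain k m where km: "\<And>i. i < j \<Longrightarrow> \<bar>of_int k * \<psi> i - of_int (m i) - \<alpha> (Suc i)\<bar> < \<epsilon>"
    by (auto simp: \<psi>_def)
  show ?thesis
  proof (rule that[of k "\<lambda>i. m (i - 1)"])
    fix i assume "i \<in> {1..j}"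
    then show "\<bar>of_int k * (\<theta> i / pi) - of_int (m (i - 1)) - \<alpha> i\<bar> < \<epsilon>"
      using km[of "i - 1"] by (auto simp: \<psi>_def split: if_splits)
  qed
qed

text \<open>The waiting time is bounded independently of the target: modulo \<open>1\<close>, every target is within \<open>\<epsilon> / 2\<close> of one of
  finitely many grid points, and each grid point is reached at some time up to \<open>\<epsilon> / 2\<close>.\<close>

lemma kronecker_mod_pi_uniform:
  fixes \<theta> :: "nat \<Rightarrow> real"
  assumes ind: "rationally_independent {0..j} (\<lambda>i. if i = 0 then pi else \<theta> i)"
    and "\<epsilon> > 0"
  obtains L :: nat where
    "\<And>\<alpha> :: nat \<Rightarrow> real. \<exists>n<L. \<forall>i\<in>{1..j}. \<exists>m::int. \<bar>real n * (\<theta> i / pi) - of_int m - \<alpha> i\<bar> < \<epsilon>"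
proof -
  obtain N :: nat where N: "1 / real N < \<epsilon> / 2" "N > 0"
    by (metis \<open>\<epsilon> > 0\<close> gr_zeroI half_gt_zero inverse_eq_divide real_arch_inverse)
  define G where "G = ({1..j} \<rightarrow>\<^sub>E {0..<N})"
  have "\<exists>k::int. \<forall>i\<in>{1..j}. \<exists>m::int. \<bar>of_int k * (\<theta> i / pi) - of_int m - real (g i) / N\<bar> < \<epsilon> / 2"
    for g
    by (rule kronecker_mod_pi[OF ind half_gt_zero[OF \<open>\<epsilon> > 0\<close>], of "\<lambda>i. real (g i) / N"]) blast
  then obtain k :: "(nat \<Rightarrow> nat) \<Rightarrow> int" where k: "\<And>g i. i \<in> {1..j} \<Longrightarrow>
      \<exists>m::int. \<bar>of_int (k g) * (\<theta> i / pi) - of_int m - real (g i) / N\<bar> < \<epsilon> / 2"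
    by metis
  have "finite G" by (auto simp: G_def intro!: finite_PiE)
  then obtain B where B: "\<And>g. g \<in> G \<Longrightarrow> \<bar>k g\<bar> \<le> B"
    by (metis (no_types, lifting) bdd_above.unfold bdd_above_finite finite_imageI imageI)
  \<comment> \<open>Kronecker's theorem yields times \<open>k g\<close> of either sign. Aiming at the target moved back by \<open>B\<close>
    rotations makes \<open>k g + B \<ge> 0\<close> a time for the target itself.\<close>
  have "\<exists>n<nat (2 * B + 1). \<forall>i\<in>{1..j}. \<exists>m::int. \<bar>real n * (\<theta> i / pi) - of_int m - \<alpha> i\<bar> < \<epsilon>"
    for \<alpha> :: "nat \<Rightarrow> real"
  proof -
    define \<beta> where "\<beta> i = \<alpha> i - of_int B * (\<theta> i / pi)" for i
    define g where "g = restrict (\<lambda>i. nat \<lfloor>N * frac (\<beta> i)\<rfloor>) {1..j}"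
    have fl: "0 \<le> \<lfloor>N * frac (\<beta> i)\<rfloor>" "\<lfloor>N * frac (\<beta> i)\<rfloor> < int N" for i
    proof -
      show "0 \<le> \<lfloor>N * frac (\<beta> i)\<rfloor>" by simp
      have "N * frac (\<beta> i) < N" using N frac_lt_1[of "\<beta> i"] by simp
      then show "\<lfloor>N * frac (\<beta> i)\<rfloor> < int N" by (simp add: floor_less_iff)
    qed
    have "g \<in> G"
      unfolding G_def g_def restrict_PiE_iff using fl by (auto simp: nat_less_iff)
    define n where "n = nat (k g + B)"
    have n: "int n = k g + B" "n < nat (2 * B + 1)"
      using B[OF \<open>g \<in> G\<close>] by (auto simp: n_def)
    have "\<exists>m::int. \<bar>real n * (\<theta> i / pi) - of_int m - \<alpha> i\<bar> < \<epsilon>" if i: "i \<in> {1..j}" for i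
    proof -
      obtain m :: int where m: "\<bar>of_int (k g) * (\<theta> i / pi) - of_int m - real (g i) / N\<bar> < \<epsilon> / 2"
        using k[OF i] by blast
      have "real (g i) = of_int \<lfloor>N * frac (\<beta> i)\<rfloor>" using i fl(1)[of i] by (simp add: g_def)
      then have "\<bar>real (g i) - N * frac (\<beta> i)\<bar> \<le> 1" by linarith
      then have "\<bar>real (g i) - N * frac (\<beta> i)\<bar> / N \<le> 1 / N" by (simp add: divide_right_mono)
      moreover have "\<bar>real (g i) - N * frac (\<beta> i)\<bar> / N = \<bar>real (g i) / N - frac (\<beta> i)\<bar>"
      proof -
        have "real (g i) / N - frac (\<beta> i) = (real (g i) - N * frac (\<beta> i)) / N"
          using N by (simp add: diff_divide_distrib)
        then show ?thesis by (simp add: abs_divide)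
      qed
      ultimately have 2: "\<bar>real (g i) / N - frac (\<beta> i)\<bar> < \<epsilon> / 2" using N by linarith
      have "real n = of_int (k g) + of_int B" using n(1) by linarith
      then have "real n * (\<theta> i / pi) - of_int (m - \<lfloor>\<beta> i\<rfloor>) - \<alpha> i
          = (of_int (k g) * (\<theta> i / pi) - of_int m - real (g i) / N) + (real (g i) / N - frac (\<beta> i))"
        by (simp add: \<beta>_def frac_def algebra_simps)
      moreover have "\<bar>x + y\<bar> < \<epsilon>" if "\<bar>x\<bar> < \<epsilon> / 2" "\<bar>y\<bar> < \<epsilon> / 2" for x y
        using that by linarith
      ultimately have "\<bar>real n * (\<theta> i / pi) - of_int (m - \<lfloor>\<beta> i\<rfloor>) - \<alpha> i\<bar> < \<epsilon>"
        using m 2 by metis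
      then show ?thesis by blast
    qed
    with n(2) show ?thesis by blast
  qed
  then show ?thesis by (rule that)
qed

section \<open>Kicks that shrink a rotating point\<close>

definition kick :: "real \<Rightarrow> complex \<Rightarrow> complex" where
  "kick s z = z + of_real (s * Im z)"

text \<open>With \<open>z = r * cis \<phi>\<close> the condition reads \<open>c * sin (2 * \<phi>) \<le> - \<bar>c\<bar> / 2\<close>, which demands half of the
  strongest first-order decrease that a kick can cause.\<close>

definition shrinks :: "real \<Rightarrow> complex \<Rightarrow> bool" where
  "shrinks c z \<longleftrightarrow> 2 * c * Re z * Im z \<le> - \<bar>c\<bar> / 2 * (cmod z)\<^sup>2"

lemma kick_0 [simp]: "kick 0 z = z"
  by (simp add: kick_def)

text \<open>To first order in \<open>p\<close> a kick changes \<open>\<bar>z\<bar>\<^sup>2\<close> by \<open>2 * p * c * Re z * Im z \<le> - p * \<bar>c\<bar> / 2 * \<bar>z\<bar>\<^sup>2\<close>, and the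
  smallness of \<open>p * \<bar>c\<bar>\<close> lets the second-order term consume at most half of this gain.\<close>

lemma kick_contracts:
  assumes "shrinks c z" and "p \<ge> 0" and "p * \<bar>c\<bar> \<le> 1/4"
  shows "(cmod (kick (p * c) z))\<^sup>2 \<le> (1 - p * \<bar>c\<bar> / 4) * (cmod z)\<^sup>2"
proof -
  have "(cmod (kick (p * c) z))\<^sup>2 = (cmod z)\<^sup>2 + p * (2 * c * Re z * Im z) + (p * c)\<^sup>2 * (Im z)\<^sup>2"
    unfolding cmod_power2 by (simp add: kick_def power2_eq_square algebra_simps)
  also have "p * (2 * c * Re z * Im z) \<le> p * (- \<bar>c\<bar> / 2 * (cmod z)\<^sup>2)"
    using assms by (intro mult_left_mono) (auto simp: shrinks_def)
  also have "(p * c)\<^sup>2 * (Im z)\<^sup>2 \<le> (p * \<bar>c\<bar> / 4) * (cmod z)\<^sup>2"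
  proof (rule mult_mono)
    have "(p * c)\<^sup>2 = (p * \<bar>c\<bar>) * (p * \<bar>c\<bar>)"
      by (simp add: power2_eq_square abs_mult_self_eq algebra_simps)
    also have "\<dots> \<le> (p * \<bar>c\<bar>) * (1/4)" using assms by (intro mult_left_mono) auto
    finally show "(p * c)\<^sup>2 \<le> p * \<bar>c\<bar> / 4" by simp
  qed (use assms in \<open>auto simp: cmod_power2\<close>)
  finally show ?thesis by (simp add: algebra_simps)
qed

text \<open>The strongest decrease occurs at \<open>\<phi> = - sgn c * \<pi> / 4\<close> modulo \<open>\<pi>\<close>; at distance less than \<open>\<pi> / 6\<close> from there
  the doubled angle is off by less than \<open>\<pi> / 3\<close>, whose cosine is \<open>1 / 2\<close>.\<close>

lemma shrinks_near_target:
  assumes "\<bar>\<phi> / pi - of_int m - (- sgn c / 4)\<bar> < 1/6"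
  shows "shrinks c (of_real r * cis \<phi>)"
proof -
  define d where "d = \<phi> / pi - of_int m + sgn c / 4"
  have d: "\<bar>d\<bar> < 1/6" using assms by (simp add: d_def)
  have "2 * \<phi> = (2 * pi * d - sgn c * (pi / 2)) + 2 * pi * of_int m"
    by (simp add: d_def field_simps)
  then have "sin (2 * \<phi>) = sin (2 * pi * d - sgn c * (pi / 2))"
    by (simp only: sin_add[of _ "2 * pi * of_int m"] sin_int_2pin cos_int_2pin
        mult_1_right mult_zero_right add_0_right)
  then have s: "c * sin (2 * \<phi>) = - \<bar>c\<bar> * cos (2 * pi * d)"
    by (cases "c > 0"; cases "c = 0") (auto simp: sin_diff sin_add)
  have "cos (pi / 3) \<le> cos \<bar>2 * pi * d\<bar>"
    using d by (intro cos_monotone_0_pi_le) (auto simp: abs_mult)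
  then have "1 / 2 \<le> cos (2 * pi * d)" by (simp add: cos_60)
  then have "- \<bar>c\<bar> * cos (2 * pi * d) \<le> - \<bar>c\<bar> * (1 / 2)"
    by (intro mult_left_mono_neg) auto
  with s have "c * sin (2 * \<phi>) \<le> - \<bar>c\<bar> / 2" by simp
  then have "r\<^sup>2 * (c * sin (2 * \<phi>)) \<le> r\<^sup>2 * (- \<bar>c\<bar> / 2)"
    by (intro mult_left_mono) auto
  moreover have "2 * c * Re (of_real r * cis \<phi>) * Im (of_real r * cis \<phi>) = r\<^sup>2 * (c * sin (2 * \<phi>))"
    by (simp add: sin_double power2_eq_square)
  moreover have "(cmod (of_real r * cis \<phi>))\<^sup>2 = r\<^sup>2"
    by (simp add: norm_mult)
  ultimately show ?thesis unfolding shrinks_def by (metis mult.commute)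
qed

text \<open>Under free rotation, \<open>j\<close> points on circles reach their shrinking arcs simultaneously,
  within a time that does not depend on where they start.\<close>

lemma rotation_reaches_shrinking:
  fixes \<theta> c :: "nat \<Rightarrow> real"
  assumes ind: "rationally_independent {0..j} (\<lambda>i. if i = 0 then pi else \<theta> i)"
  obtains L :: nat where
    "\<And>z :: nat \<Rightarrow> complex. \<exists>n<L. \<forall>i\<in>{1..j}. shrinks (c i) (cis (\<theta> i) ^ n * z i)"
proof -
  obtain L :: nat where L: "\<And>\<alpha> :: nat \<Rightarrow> real.
      \<exists>n<L. \<forall>i\<in>{1..j}. \<exists>m::int. \<bar>real n * (\<theta> i / pi) - of_int m - \<alpha> i\<bar> < 1/6"
    using kronecker_mod_pi_uniform[OF ind, of "1/6"] by auto
  show ?thesis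
  proof (rule that[of L])
    fix z :: "nat \<Rightarrow> complex"
    obtain n where n: "n < L" "\<And>i. i \<in> {1..j} \<Longrightarrow>
        \<exists>m::int. \<bar>real n * (\<theta> i / pi) - of_int m - (- sgn (c i) / 4 - Arg (z i) / pi)\<bar> < 1/6"
      using L[of "\<lambda>i. - sgn (c i) / 4 - Arg (z i) / pi"] by blast
    have "shrinks (c i) (cis (\<theta> i) ^ n * z i)" if i: "i \<in> {1..j}" for i
    proof -
      obtain m :: int where
        m: "\<bar>real n * (\<theta> i / pi) - of_int m - (- sgn (c i) / 4 - Arg (z i) / pi)\<bar> < 1/6"
        using n(2)[OF i] by blast
      have "real n * (\<theta> i / pi) - of_int m - (- sgn (c i) / 4 - Arg (z i) / pi)
          = (real n * \<theta> i + Arg (z i)) / pi - of_int m - (- sgn (c i) / 4)"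
        by (simp add: add_divide_distrib)
      with m have "shrinks (c i) (of_real (cmod (z i)) * cis (real n * \<theta> i + Arg (z i)))"
        by (intro shrinks_near_target[of _ m]) metis
      also have "of_real (cmod (z i)) * cis (real n * \<theta> i + Arg (z i)) = cis (\<theta> i) ^ n * z i"
        using rcis_cmod_Arg[of "z i"] by (simp add: rcis_def Complex.DeMoivre mult_ac flip: cis_mult)
      finally show ?thesis .
    qed
    with n(1) show "\<exists>n<L. \<forall>i\<in>{1..j}. shrinks (c i) (cis (\<theta> i) ^ n * z i)" by blast
  qed
qed

section \<open>A slowly growing number of active points\<close>

text \<open>Time is cut into blocks: \<open>st k\<close> is the first time of the block containing \<open>k\<close>, and \<open>lev k\<close>, constant on
  each block, is the number of points treated there. A block of level \<open>j\<close> has length \<open>L j\<close> and begins no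
  earlier than \<open>N j\<close>, the time from which level \<open>j\<close> is admissible. As the length of a block exceeds its starting
  time at most by one, times in the same block are comparable; the level still tends to infinity, since the highest level that
  is admissible and does not exceed the starting time is chosen for each block.\<close>

lemma level_schedule:
  fixes N :: "nat \<Rightarrow> nat" and L :: "nat \<Rightarrow> nat"
  assumes "\<And>j. L j \<ge> 1" and "L 0 = 1" and "N 0 = 0" and LN: "\<And>j. L j \<le> N j + 1"
  obtains st lev :: "nat \<Rightarrow> nat" where
    "\<And>k. st k \<le> k" "\<And>k. k \<le> 2 * st k" "\<And>k m. st k \<le> m \<Longrightarrow> m \<le> k \<Longrightarrow> st m = st k"
    "\<And>k. lev k = lev (st k)"
    "\<And>k. N (lev k) \<le> st k" "\<And>k. k < st k + L (lev k)"
    "\<And>k. st (Suc k) = st k \<or> st (Suc k) = Suc k \<and> Suc k = st k + L (lev k)"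
    "\<And>j. \<exists>k0. \<forall>k\<ge>k0. j \<le> lev k"
proof -
  define J where "J s = Max {j. j \<le> s \<and> N j \<le> s}" for s
  have J: "J s \<le> s" "N (J s) \<le> s" for s
  proof -
    have "J s \<in> {j. j \<le> s \<and> N j \<le> s}"
      unfolding J_def using assms(3) by (intro Max_in) auto
    then show "J s \<le> s" "N (J s) \<le> s" by auto
  qed
  have J_ge: "j \<le> J s" if "j \<le> s" "N j \<le> s" for j s
    unfolding J_def using that by (intro Max_ge) auto
  define st where "st = rec_nat 0 (\<lambda>k s. if Suc k = s + L (J s) then Suc k else s)"
  have st0: "st 0 = 0" and stS: "st (Suc k) = (if Suc k = st k + L (J (st k)) then Suc k else st k)" for k
    by (simp_all add: st_def)
  define lev where "lev k = J (st k)" for k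
  have b: "st k \<le> k \<and> k < st k + L (lev k)" for k
  proof (induction k)
    case 0
    then show ?case using assms(1)[of "lev 0"] by (simp add: st0)
  next
    case (Suc k)
    show ?case
    proof (cases "Suc k = st k + L (J (st k))")
      case True
      then have "st (Suc k) = Suc k" using stS[of k] by presburger
      then show ?thesis
        using assms(1)[of "lev (Suc k)"] by linarith
    next
      case False
      then have "st (Suc k) = st k" by (simp add: stS)
      then show ?thesis using Suc False by (simp add: lev_def)
    qed
  qed
  have c: "st m = st k" if "st k \<le> m" "m \<le> k" for k m
    using that
  proof (induction k)
    case (Suc k)
    then show ?case by (cases "m = Suc k") (auto simp: stS split: if_splits)
  qed simp
  have ss: "st (st k) = st k" for k using c[of k "st k"] b[of k] by simp
  have d: "k \<le> 2 * st k" for k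
  proof (cases "st k = 0")
    case True
    then have "lev k = 0" using J(1)[of 0] by (simp add: lev_def)
    then show ?thesis using b[of k] assms(2) True by simp
  next
    case False
    then show ?thesis using b[of k] LN[of "lev k"] J(2)[of "st k"] by (simp add: lev_def)
  qed
  show ?thesis
  proof (rule that[of st lev])
    fix j
    have "j \<le> lev k" if "k \<ge> 2 * max j (N j)" for k
      unfolding lev_def using that d[of k] by (intro J_ge) auto
    then show "\<exists>k0. \<forall>k\<ge>k0. j \<le> lev k" by blast
  qed (use b c d J ss in \<open>auto simp: lev_def stS ss\<close>)
qed

section \<open>Simultaneous decay of all points\<close>

text \<open>The kick \<open>p k\<close> is chosen from the state at time \<open>k\<close> and determines the state at
  time \<open>k + 1\<close>, so both are obtained by one recursion.\<close>

lemma feedback_system: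
  fixes step :: "nat \<Rightarrow> 'p \<Rightarrow> 's \<Rightarrow> 's" and rule :: "nat \<Rightarrow> 's \<Rightarrow> 'p"
  obtains p Z where "Z 0 = z0" "\<And>k. Z (Suc k) = step k (p k) (Z k)" "\<And>k. p k = rule k (Z k)"
proof -
  define Z where "Z = rec_nat z0 (\<lambda>k v. step k (rule k v) v)"
  show ?thesis by (rule that[of Z "\<lambda>k. rule k (Z k)"]) (simp_all add: Z_def)
qed

text \<open>The constants are tuned as follows. In a block of level \<open>j\<close> a kick at time \<open>k\<close> has size \<open>A j / k\<close> with
  \<open>A j * \<bar>c i\<bar> \<ge> 16 * L j\<close> for the active points, so it contributes the factor \<open>1 - 4 * L j / k\<close> at
  most. If the block starts at \<open>s \<ge> L j\<close>, then \<open>k \<le> 2 * s\<close> and the factor is at most \<open>1 - 2 * t\<close> with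
  \<open>t = L j / s\<close>, which beats the growth \<open>(1 + t)\<^sup>2\<close> of the squared time over the block. Level \<open>j\<close> is
  admissible once \<open>k \<ge> L j\<close> and \<open>A j / k\<close> is below \<open>\<delta> k\<close> and small enough for \<open>kick_contracts\<close>.\<close>

theorem common_decay:
  fixes \<theta> c \<delta> :: "nat \<Rightarrow> real" and z0 :: "nat \<Rightarrow> complex"
  assumes ind: "\<And>j. j \<ge> 1 \<Longrightarrow> rationally_independent {0..j} (\<lambda>i. if i = 0 then pi else \<theta> i)"
    and c: "\<And>i. i \<ge> 1 \<Longrightarrow> c i \<noteq> 0"
    and \<delta>: "\<And>k. \<delta> k > 0" and \<delta>_lim: "filterlim (\<lambda>k. real k * \<delta> k) at_top sequentially"
  shows "\<exists>p Z. (\<forall>k. \<bar>p k\<bar> \<le> \<delta> k) \<and> (\<forall>i. Z 0 i = z0 i) \<and>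
    (\<forall>k i. Z (Suc k) i = cis (\<theta> i) * kick (p k * c i) (Z k i)) \<and>
    (\<forall>i\<ge>1. \<exists>C. \<forall>k\<ge>1. (cmod (Z k i))\<^sup>2 \<le> C / (real k)\<^sup>2)"
proof -
  have "\<exists>L>0. (j = 0 \<longrightarrow> L = 1) \<and>
      (\<forall>z :: nat \<Rightarrow> complex. \<exists>n<L. \<forall>i\<in>{1..j}. shrinks (c i) (cis (\<theta> i) ^ n * z i))" for j
  proof (cases "j = 0")
    case False
    then have "j \<ge> 1" by simp
    from rotation_reaches_shrinking[OF ind[OF this], of c]
    obtain L where L: "\<And>z :: nat \<Rightarrow> complex. \<exists>n<L. \<forall>i\<in>{1..j}. shrinks (c i) (cis (\<theta> i) ^ n * z i)"
      by blast
    then have "L > 0" by (metis not_less_zero gr0I)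
    with L False show ?thesis by blast
  qed (auto intro!: exI[of _ 1])
  then obtain L where L_pos: "\<And>j. L j > 0" and L0: "L 0 = 1"
    and L: "\<And>j (z :: nat \<Rightarrow> complex). \<exists>n<L j. \<forall>i\<in>{1..j}. shrinks (c i) (cis (\<theta> i) ^ n * z i)"
    by metis
  have "\<exists>g>0. \<forall>i\<in>{1..j}. g \<le> \<bar>c i\<bar>" for j
  proof -
    define g where "g = Min (insert 1 ((\<lambda>i. \<bar>c i\<bar>) ` {1..j}))"
    have "g \<in> insert 1 ((\<lambda>i. \<bar>c i\<bar>) ` {1..j})" unfolding g_def by (intro Min_in) auto
    then have "g > 0" using c by fastforce
    moreover have "\<forall>i\<in>{1..j}. g \<le> \<bar>c i\<bar>" unfolding g_def by (intro ballI Min_le) auto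
    ultimately show ?thesis by blast
  qed
  then obtain g where g: "\<And>j. g j > 0" "\<And>i j. i \<in> {1..j} \<Longrightarrow> g j \<le> \<bar>c i\<bar>" by metis
  define A where "A j = 16 * real (L j) / g j" for j
  have A: "A j > 0" for j using L_pos[of j] g(1)[of j] by (simp add: A_def)
  have "\<exists>n\<ge>L j. \<forall>k\<ge>n. A j \<le> k * \<delta> k \<and> (\<forall>i\<in>{1..j}. 4 * A j * \<bar>c i\<bar> \<le> real k)" for j
  proof -
    have 1: "\<forall>\<^sub>F k in sequentially. A j \<le> real k * \<delta> k"
      using \<delta>_lim by (simp add: filterlim_at_top)
    have 2: "\<forall>\<^sub>F k in sequentially. \<forall>i\<in>{1..j}. 4 * A j * \<bar>c i\<bar> \<le> real k"
      using filterlim_real_sequentially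
      by (intro eventually_ball_finite) (auto simp: filterlim_at_top)
    from eventually_conj[OF 1 2] obtain n where
      "\<forall>k\<ge>n. A j \<le> real k * \<delta> k \<and> (\<forall>i\<in>{1..j}. 4 * A j * \<bar>c i\<bar> \<le> real k)"
      unfolding eventually_sequentially by blast
    then show ?thesis by (intro exI[of _ "max n (L j)"]) auto
  qed
  then obtain N' where N': "\<And>j. N' j \<ge> L j" "\<And>j k. k \<ge> N' j \<Longrightarrow> A j \<le> k * \<delta> k"
    "\<And>i j k. k \<ge> N' j \<Longrightarrow> i \<in> {1..j} \<Longrightarrow> 4 * A j * \<bar>c i\<bar> \<le> real k"
    by metis
  define N where "N j = (if j = 0 then 0 else N' j)" for j
  obtain st lev where st: "\<And>k. st k \<le> k" "\<And>k. k \<le> 2 * st k"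
      "\<And>k m. st k \<le> m \<Longrightarrow> m \<le> k \<Longrightarrow> st m = st k"
      "\<And>k. lev k = lev (st k)"
      "\<And>k. N (lev k) \<le> st k" "\<And>k. k < st k + L (lev k)"
      "\<And>k. st (Suc k) = st k \<or> st (Suc k) = Suc k \<and> Suc k = st k + L (lev k)"
      "\<And>j. \<exists>k0. \<forall>k\<ge>k0. j \<le> lev k"
  proof (rule level_schedule[of L N])
    show "1 \<le> L j" for j using L_pos[of j] by simp
    show "L j \<le> N j + 1" for j using L0 N'(1)[of j] by (simp add: N_def)
  qed (use L0 in \<open>auto simp: N_def\<close>)
  define rule where "rule k v = (if lev k \<ge> 1 \<and> (\<forall>i\<in>{1..lev k}. shrinks (c i) (v i))
      then A (lev k) / real k else 0)" for k and v :: "nat \<Rightarrow> complex"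
  obtain p Z where Z0: "Z 0 = z0"
    and ZS: "\<And>k. Z (Suc k) = (\<lambda>i. cis (\<theta> i) * kick (p k * c i) (Z k i))"
    and p: "\<And>k. p k = rule k (Z k)"
    using feedback_system[of z0 "\<lambda>k q v i. cis (\<theta> i) * kick (q * c i) (v i)" rule] by blast
  have k_ge: "N' (lev k) \<le> st k" if "lev k \<ge> 1" for k
    using st(5)[of k] that by (simp add: N_def)
  have st_pos: "st k \<ge> 1" if "lev k \<ge> 1" for k
    using k_ge[OF that] N'(1)[of "lev k"] L_pos[of "lev k"] by linarith
  have p_bounds: "0 \<le> p k \<and> p k \<le> \<delta> k" for k
  proof (cases "p k = 0")
    case True
    then show ?thesis using \<delta>[of k] by simp
  next
    case False
    then have l: "lev k \<ge> 1" "p k = A (lev k) / k" by (auto simp: p rule_def split: if_splits)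
    have "k \<ge> 1" using st_pos[OF l(1)] st(1)[of k] by linarith
    moreover have "A (lev k) \<le> k * \<delta> k" using N'(2)[of "lev k" k] k_ge[OF l(1)] st(1)[of k] by simp
    ultimately show ?thesis
      using l(2) A[of "lev k"] by (simp add: pos_divide_le_eq mult.commute)
  qed
  have free: "Z (s + n) i = cis (\<theta> i) ^ n * Z s i" if "\<And>m. m < n \<Longrightarrow> p (s + m) = 0" for s n i
    using that by (induction n) (auto simp: ZS)
  have event: "(cmod (Z (Suc k) i))\<^sup>2 \<le> (1 - 4 * L (lev k) / k) * (cmod (Z k i))\<^sup>2"
    if i: "i \<in> {1..lev k}" and nz: "p k \<noteq> 0" for k i
  proof -
    have l: "lev k \<ge> 1" "p k = A (lev k) / k" and sh: "shrinks (c i) (Z k i)"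
      using nz i by (auto simp: p rule_def split: if_splits)
    have k: "k \<ge> 1" "k \<ge> N' (lev k)" using st_pos[OF l(1)] k_ge[OF l(1)] st(1)[of k] by linarith+
    have "p k * \<bar>c i\<bar> \<le> 1/4" using N'(3)[OF k(2) i] k(1) by (simp add: l(2) field_simps)
    then have "(cmod (kick (p k * c i) (Z k i)))\<^sup>2 \<le> (1 - p k * \<bar>c i\<bar> / 4) * (cmod (Z k i))\<^sup>2"
      using p_bounds[of k] sh by (intro kick_contracts) auto
    also have "\<dots> \<le> (1 - 4 * L (lev k) / k) * (cmod (Z k i))\<^sup>2"
    proof (rule mult_right_mono)
      have "16 * real (L (lev k)) = A (lev k) * g (lev k)"
        using g(1)[of "lev k"] by (simp add: A_def)
      also have "\<dots> \<le> A (lev k) * \<bar>c i\<bar>"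
        using g(2)[OF i] A[of "lev k"] by (intro mult_left_mono) auto
      finally show "1 - p k * \<bar>c i\<bar> / 4 \<le> 1 - 4 * L (lev k) / k"
        using k(1) by (simp add: l(2) divide_simps)
    qed simp
    finally show ?thesis by (simp add: ZS norm_mult)
  qed
  have nonexpansive: "(cmod (Z (Suc k) i))\<^sup>2 \<le> (cmod (Z k i))\<^sup>2" if i: "i \<in> {1..lev k}" for k i
  proof (cases "p k = 0")
    case False
    have "(1 - 4 * L (lev k) / k) * (cmod (Z k i))\<^sup>2 \<le> 1 * (cmod (Z k i))\<^sup>2"
      by (intro mult_right_mono) auto
    with event[OF i False] show ?thesis by linarith
  qed (simp add: ZS norm_mult)
  have mono: "(cmod (Z m' i))\<^sup>2 \<le> (cmod (Z m i))\<^sup>2"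
    if "m \<le> m'" "\<And>k. m \<le> k \<Longrightarrow> k < m' \<Longrightarrow> i \<in> {1..lev k}" for m m' i
    using that
  proof (induction m' rule: dec_induct)
    case (step k)
    then show ?case using nonexpansive[of i k] by fastforce
  qed simp
  have block: "(real (s + L j))\<^sup>2 * (cmod (Z (s + L j) i))\<^sup>2 \<le> (real s)\<^sup>2 * (cmod (Z s i))\<^sup>2"
    if lev: "\<And>m. s \<le> m \<Longrightarrow> m < s + L j \<Longrightarrow> lev m = j" and i: "i \<in> {1..j}" and s: "s \<ge> L j" for s i j
  proof -
    \<comment> \<open>Without a kick in the block the rotation would be free, and then a kick would be due.\<close>
    have "\<exists>n<L j. p (s + n) \<noteq> 0"
    proof (rule ccontr)
      assume "\<not> ?thesis"
      then have 0: "\<And>n. n < L j \<Longrightarrow> p (s + n) = 0" by blast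
      obtain n where n: "n < L j" "\<forall>i\<in>{1..j}. shrinks (c i) (cis (\<theta> i) ^ n * Z s i)"
        using L by blast
      have "Z (s + n) i = cis (\<theta> i) ^ n * Z s i" for i
        using n(1) by (intro free 0) auto
      then have "p (s + n) = A j / (s + n)"
        using n i lev[of "s + n"] by (simp add: p rule_def)
      moreover have "s + n > 0" using L_pos[of j] s by linarith
      ultimately show False using 0[OF n(1)] A[of j] by simp
    qed
    then obtain n where n: "n < L j" "p (s + n) \<noteq> 0" by blast
    define t where "t = L j / real s"
    have s0: "real s > 0" and t: "0 \<le> t" "t \<le> 1"
      using L_pos[of j] s by (auto simp: t_def)
    have "(cmod (Z (s + L j) i))\<^sup>2 \<le> (cmod (Z (Suc (s + n)) i))\<^sup>2"
      using n(1) lev i by (intro mono) auto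
    also have "\<dots> \<le> (1 - 4 * L j / (s + n)) * (cmod (Z (s + n) i))\<^sup>2"
      using event[of i "s + n"] n lev[of "s + n"] i by simp
    also have "\<dots> \<le> (1 - 2 * t) * (cmod (Z (s + n) i))\<^sup>2"
    proof (rule mult_right_mono)
      have "real (s + n) \<le> 2 * real s" using n(1) s by linarith
      then have "4 * L j / (2 * real s) \<le> 4 * L j / (s + n)"
        using s0 by (intro divide_left_mono) auto
      then show "1 - 4 * L j / (s + n) \<le> 1 - 2 * t" by (simp add: t_def)
    qed simp
    finally have 1: "(cmod (Z (s + L j) i))\<^sup>2 \<le> (1 - 2 * t) * (cmod (Z (s + n) i))\<^sup>2" .
    have 2: "(cmod (Z (s + n) i))\<^sup>2 \<le> (cmod (Z s i))\<^sup>2"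
      using n(1) lev i by (intro mono) auto
    have "(1 + t)\<^sup>2 * (cmod (Z (s + L j) i))\<^sup>2 \<le> (1 + t)\<^sup>2 * ((1 - 2 * t) * (cmod (Z (s + n) i))\<^sup>2)"
      using 1 by (intro mult_left_mono) auto
    also have "\<dots> = ((1 + t)\<^sup>2 * (1 - 2 * t)) * (cmod (Z (s + n) i))\<^sup>2" by simp
    also have "\<dots> \<le> 1 * (cmod (Z (s + n) i))\<^sup>2"
    proof (rule mult_right_mono)
      have "(1 + t)\<^sup>2 * (1 - 2 * t) = 1 - 3 * t\<^sup>2 - 2 * (t * t\<^sup>2)"
        by (simp add: power2_eq_square algebra_simps)
      also have "\<dots> \<le> 1"
        using mult_nonneg_nonneg[OF t(1) zero_le_power2[of t]] zero_le_power2[of t] by linarith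
      finally show "(1 + t)\<^sup>2 * (1 - 2 * t) \<le> 1" .
    qed simp
    finally have "(1 + t)\<^sup>2 * (cmod (Z (s + L j) i))\<^sup>2 \<le> (cmod (Z s i))\<^sup>2" using 2 by linarith
    then have "(real s)\<^sup>2 * ((1 + t)\<^sup>2 * (cmod (Z (s + L j) i))\<^sup>2) \<le> (real s)\<^sup>2 * (cmod (Z s i))\<^sup>2"
      by (intro mult_left_mono) auto
    moreover have "real (s + L j) = real s * (1 + t)" using s0 by (simp add: t_def field_simps)
    ultimately show ?thesis by (simp add: power_mult_distrib mult.assoc)
  qed
  have decay: "\<exists>C. \<forall>k\<ge>1. (cmod (Z k i))\<^sup>2 \<le> C / (real k)\<^sup>2" if i: "i \<ge> 1" for i
  proof -
    obtain k0 where k0: "\<And>k. k \<ge> k0 \<Longrightarrow> i \<le> lev k" using st(8)[of i] by blast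
    define W where "W k = (real k)\<^sup>2 * (cmod (Z k i))\<^sup>2" for k
    have W0: "W k \<ge> 0" for k by (simp add: W_def)
    have lev_eq: "lev m = lev k" if "st k \<le> m" "m \<le> k" for k m
      using st(3)[OF that] st(4)[of m] st(4)[of k] by simp
    have W_st: "W (st k) \<le> W (st k0)" if "k \<ge> k0" for k
      using that
    proof (induction k rule: dec_induct)
      case (step k)
      show ?case
      proof (cases "st (Suc k) = st k")
        case False
        then have e: "st (Suc k) = st k + L (lev k)" "Suc k = st k + L (lev k)"
          using st(7)[of k] by auto
        have l: "i \<in> {1..lev k}" using k0[of k] step(1) i by simp
        have "W (st k + L (lev k)) \<le> W (st k)"
          unfolding W_def
        proof (rule block)
          show "lev m = lev k" if "st k \<le> m" "m < st k + L (lev k)" for m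
            using that e(2) by (intro lev_eq) auto
          show "L (lev k) \<le> st k" using k_ge[of k] N'(1)[of "lev k"] l by simp
        qed (rule l)
        then show ?thesis using step e(1) by simp
      qed (use step in simp)
    qed simp
    have W_late: "W k \<le> 4 * W (st k0)" if "k \<ge> k0" for k
    proof -
      have l: "i \<in> {1..lev k}" using k0[OF that] i by simp
      have "(cmod (Z k i))\<^sup>2 \<le> (cmod (Z (st k) i))\<^sup>2"
        using l st(1) lev_eq by (intro mono) auto
      moreover have "(real k)\<^sup>2 \<le> (2 * real (st k))\<^sup>2"
        using st(2)[of k] by (intro power_mono) auto
      ultimately have "W k \<le> (2 * real (st k))\<^sup>2 * (cmod (Z (st k) i))\<^sup>2"
        unfolding W_def by (intro mult_mono) auto
      also have "\<dots> = 4 * W (st k)" by (simp add: W_def power_mult_distrib)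
      finally show ?thesis using W_st[OF that] by simp
    qed
    \<comment> \<open>The sum takes care of the times before the point becomes active.\<close>
    define C where "C = 4 * W (st k0) + (\<Sum>k<k0. W k)"
    have "W k \<le> C" for k
    proof (cases "k < k0")
      case True
      then have "W k \<le> (\<Sum>k<k0. W k)" using W0 by (intro member_le_sum) auto
      then show ?thesis using W0[of "st k0"] by (simp add: C_def)
    next
      case False
      moreover have "(\<Sum>k<k0. W k) \<ge> 0" using W0 by (intro sum_nonneg) auto
      ultimately show ?thesis using W_late[of k] by (simp add: C_def)
    qed
    then show ?thesis by (intro exI[of _ C]) (auto simp: W_def field_simps)
  qed
  show ?thesis
    using p_bounds Z0 ZS decay by (intro exI[of _ p] exI[of _ Z]) auto
qed

section \<open>Jacobi operators at elliptic energies\<close>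

lemma periodic_multiple:
  assumes "period_jacobi T a b" and "n \<ge> 1"
  shows "a (k * T + n) = a n" and "b (k * T + n) = b n"
proof -
  have "a (k * T + n) = a n \<and> b (k * T + n) = b n"
  proof (induction k)
    case (Suc k)
    have "k * T + n \<ge> 1" using assms(2) by simp
    then have "a (k * T + n + T) = a (k * T + n)" "b (k * T + n + T) = b (k * T + n)"
      using assms(1) by (auto simp: period_jacobi_def)
    then show ?case using Suc by (simp add: ac_simps)
  qed simp
  then show "a (k * T + n) = a n" "b (k * T + n) = b n" by auto
qed

lemma transfer_product_propagates:
  assumes a: "\<And>m. 1 \<le> m \<Longrightarrow> m \<le> n \<Longrightarrow> a m \<noteq> 0"
    and rec: "\<And>m. 1 \<le> m \<Longrightarrow> m \<le> n \<Longrightarrow>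
      (if m = 1 then a T else a (m - 1)) * y (m - 1) + b m * y m + a m * y (Suc m) = x * y m"
  shows "transfer_product T a b x n *v vector [y 0, y 1] = vector [y n, y (Suc n)]"
  using assms
proof (induction n)
  case (Suc n)
  have "transfer_product T a b x n *v vector [y 0, y 1] = vector [y n, y (Suc n)]"
    using Suc.prems by (intro Suc.IH) auto
  then have "transfer_product T a b x (Suc n) *v vector [y 0, y 1] =
      transfer_matrix T a b x (Suc n) *v vector [y n, y (Suc n)]"
    by (simp flip: matrix_vector_mul_assoc)
  also have "\<dots> = vector [y (Suc n), y (Suc (Suc n))]"
  proof -
    define a' where "a' = (if Suc n = 1 then a T else a (Suc n - 1))"
    have matrix: "transfer_matrix T a b x (Suc n) =
        vector [vector [0, 1], vector [- a' / a (Suc n), (x - b (Suc n)) / a (Suc n)]]"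
      by (simp only: transfer_matrix_def a'_def)
    have "a' * y n + b (Suc n) * y (Suc n) + a (Suc n) * y (Suc (Suc n)) = x * y (Suc n)"
      using Suc.prems(2)[of "Suc n"] by (simp add: a'_def)
    then have "a (Suc n) * y (Suc (Suc n)) = (x - b (Suc n)) * y (Suc n) - a' * y n"
      by (simp add: algebra_simps)
    then have "y (Suc (Suc n)) = ((x - b (Suc n)) * y (Suc n) - a' * y n) / a (Suc n)"
      using Suc.prems(1)[of "Suc n"] by (simp add: eq_divide_eq mult.commute)
    then have "- a' / a (Suc n) * y n + (x - b (Suc n)) / a (Suc n) * y (Suc n) = y (Suc (Suc n))"
      by (simp add: diff_divide_distrib left_diff_distrib)
    then show ?thesis
      using matrix by (simp add: vec_eq_iff forall_2 matrix_vector_mult_def sum_2)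
  qed
  finally show ?case .
qed simp

text \<open>The value \<open>0\<close> at \<open>0\<close> makes the general recursion cover the first equation as well, since it
  cancels the arbitrary entry \<open>a 0\<close>.\<close>

fun jacobi_solution :: "(nat \<Rightarrow> real) \<Rightarrow> (nat \<Rightarrow> real) \<Rightarrow> real \<Rightarrow> nat \<Rightarrow> real" where
  "jacobi_solution a b x 0 = 0"
| "jacobi_solution a b x (Suc 0) = 1"
| "jacobi_solution a b x (Suc (Suc n)) =
     ((x - b (Suc n)) * jacobi_solution a b x (Suc n) - a n * jacobi_solution a b x n) / a (Suc n)"

lemma jacobi_op_jacobi_solution:
  assumes "n \<ge> 1" and "a n \<noteq> 0"
  shows "jacobi_op a b (jacobi_solution a b x) n = x * jacobi_solution a b x n"
proof -
  obtain m where n: "n = Suc m" using assms(1) by (cases n) auto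
  let ?u = "jacobi_solution a b x"
  have rec: "a (Suc m) * ?u (Suc (Suc m)) = (x - b (Suc m)) * ?u (Suc m) - a m * ?u m"
    using assms(2) by (simp add: n)
  show ?thesis
  proof (cases "m = 0")
    case True
    then show ?thesis using rec by (simp add: n jacobi_op_def numeral_2_eq_2 algebra_simps)
  next
    case False
    then show ?thesis
      using rec by (simp add: n jacobi_op_def left_diff_distrib del: jacobi_solution.simps)
  qed
qed

text \<open>A potential supported on the first site of each period enters the transfer over a period only through a shear of the
  initial vector: \<open>a T * u (k * T) + q (k * T + 1) * u (k * T + 1)\<close> equals
  \<open>a T * (u (k * T) + q (k * T + 1) / a T * u (k * T + 1))\<close>.\<close>

lemma period_propagates:
  assumes per: "period_jacobi T a b"
    and sol: "\<And>n. n \<ge> 1 \<Longrightarrow> jacobi_op a b u n + q n * u n = x * u n" and "u 0 = 0"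
    and q0: "\<And>m. 2 \<le> m \<Longrightarrow> m \<le> T \<Longrightarrow> q (k * T + m) = 0"
  defines "v \<equiv> vector [u (k * T) + q (k * T + 1) / a T * u (k * T + 1), u (k * T + 1)]"
  shows "\<And>m. 1 \<le> m \<Longrightarrow> m \<le> T \<Longrightarrow>
    transfer_product T a b x m *v v = vector [u (k * T + m), u (k * T + Suc m)]"
proof -
  have T: "T \<ge> 1" and a_pos: "\<And>n. n \<ge> 1 \<Longrightarrow> a n > 0"
    using per by (auto simp: period_jacobi_def)
  \<comment> \<open>The potential at the first site of the period is absorbed into the preceding entry.\<close>
  define y where "y m = (if m = 0 then u (k * T) + q (k * T + 1) / a T * u (k * T + 1) else u (k * T + m))"
    for m
  have rec: "(if m = 1 then a T else a (m - 1)) * y (m - 1) + b m * y m + a m * y (Suc m) = x * y m"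
    if m: "1 \<le> m" "m \<le> T" for m
  proof (cases "m = 1")
    case True
    have "a (k * T) * u (k * T) = a T * u (k * T)"
    proof (cases k)
      case (Suc k')
      then show ?thesis using periodic_multiple(1)[OF per T, of k'] by (simp add: add.commute)
    qed (use \<open>u 0 = 0\<close> in simp)
    then have "a T * u (k * T) + (b 1 + q (k * T + 1)) * u (k * T + 1) + a 1 * u (k * T + 2)
        = x * u (k * T + 1)"
      using sol[of "k * T + 1"] periodic_multiple[OF per, of 1 k] \<open>u 0 = 0\<close> T
      by (cases "k = 0") (auto simp: jacobi_op_def numeral_2_eq_2 algebra_simps)
    then show ?thesis using a_pos[OF T] by (simp add: True y_def algebra_simps)
  next
    case False
    with m have "m \<ge> 2" by simp
    then have "k * T + m \<noteq> 1" "k * T + m - 1 = k * T + (m - 1)" by auto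
    then show ?thesis
      using sol[of "k * T + m"] q0[of m] m \<open>m \<ge> 2\<close> periodic_multiple[OF per, of m k]
        periodic_multiple(1)[OF per, of "m - 1" k]
      by (simp add: jacobi_op_def y_def)
  qed
  show "transfer_product T a b x m *v v = vector [u (k * T + m), u (k * T + Suc m)]"
    if m: "1 \<le> m" "m \<le> T" for m
  proof -
    have "transfer_product T a b x m *v vector [y 0, y 1] = vector [y m, y (Suc m)]"
      using m rec a_pos by (intro transfer_product_propagates) (auto simp: less_le)
    then show ?thesis using m by (simp add: y_def v_def)
  qed
qed

text \<open>The pairing of \<open>v\<close> with \<open>(M $ 2 $ 1, cis t - M $ 1 $ 1)\<close>, which is a left eigenvector of \<open>M\<close> for the
  eigenvalue \<open>cis t\<close> if \<open>det M = 1\<close> and \<open>trace M = 2 * cos t\<close>.\<close>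

definition rotating_coord :: "real^2^2 \<Rightarrow> real \<Rightarrow> real^2 \<Rightarrow> complex" where
  "rotating_coord M t v = of_real (M $ 2 $ 1 * v $ 1) + (cis t - of_real (M $ 1 $ 1)) * of_real (v $ 2)"

lemma rotating_coord_mult:
  assumes "det M = 1" and "trace M = 2 * cos t"
  shows "rotating_coord M t (M *v v) = cis t * rotating_coord M t v"
proof -
  have det: "M $ 1 $ 1 * M $ 2 $ 2 - M $ 1 $ 2 * M $ 2 $ 1 = 1"
    using assms(1) by (simp add: det_2)
  have tr: "M $ 2 $ 2 = 2 * cos t - M $ 1 $ 1"
    using assms(2) by (simp add: trace_def sum_2)
  have cs: "(sin t)\<^sup>2 = 1 - (cos t)\<^sup>2" by (simp add: sin_squared_eq)
  have d: "M $ 1 $ 2 * M $ 2 $ 1 = M $ 1 $ 1 * (2 * cos t - M $ 1 $ 1) - 1"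
    using det by (simp add: tr)
  show ?thesis
  proof (rule complex_eqI)
    show "Re (rotating_coord M t (M *v v)) = Re (cis t * rotating_coord M t v)"
      using d tr cs by (simp add: rotating_coord_def matrix_vector_mult_def sum_2) algebra
    show "Im (rotating_coord M t (M *v v)) = Im (cis t * rotating_coord M t v)"
      by (simp add: rotating_coord_def matrix_vector_mult_def sum_2 tr algebra_simps)
  qed
qed

lemma Im_rotating_coord [simp]: "Im (rotating_coord M t v) = sin t * v $ 2"
  by (simp add: rotating_coord_def)

text \<open>The shear adds a real multiple of \<open>v $ 2\<close> to the coordinate, and \<open>v $ 2\<close> is recovered from its imaginary
  part; this is how kicks arise.\<close>

lemma rotating_coord_shear:
  assumes "sin t \<noteq> 0"
  shows "rotating_coord M t (vector [v $ 1 + s * v $ 2, v $ 2]) =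
    kick (s * (M $ 2 $ 1 / sin t)) (rotating_coord M t v)"
  using assms by (simp add: kick_def) (simp add: rotating_coord_def algebra_simps)

text \<open>If the entry vanished, the eigenvalues would be the diagonal entries, two reals with product \<open>1\<close>, whose
  sum has absolute value at least \<open>2\<close>.\<close>

lemma elliptic_lower_left_nonzero:
  fixes M :: "real^2^2"
  assumes "det M = 1" and "\<bar>trace M\<bar> < 2"
  shows "M $ 2 $ 1 \<noteq> 0"
proof
  assume "M $ 2 $ 1 = 0"
  then have "M $ 1 $ 1 * M $ 2 $ 2 = 1" using assms(1) by (simp add: det_2)
  then have "(trace M)\<^sup>2 = (M $ 1 $ 1 - M $ 2 $ 2)\<^sup>2 + 4"
    by (simp add: trace_def sum_2 power2_eq_square algebra_simps)
  then have "(trace M)\<^sup>2 \<ge> 2\<^sup>2" by simp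
  then show False using assms(2) abs_le_square_iff[of 2 "trace M"] by simp
qed

lemma norm_le_rotating_coord:
  assumes "M $ 2 $ 1 \<noteq> 0" and "sin t \<noteq> 0"
  obtains B where "B > 0" "\<And>v. norm v \<le> B * cmod (rotating_coord M t v)"
proof -
  have lin: "linear (rotating_coord M t)"
    by (rule linearI) (simp_all add: complex_eq_iff rotating_coord_def algebra_simps)
  have "inj (rotating_coord M t)"
    unfolding linear_injective_0[OF lin]
  proof (intro allI impI)
    fix v assume 0: "rotating_coord M t v = 0"
    then have "Im (rotating_coord M t v) = 0" by simp
    then have "v $ 2 = 0" using assms(2) by simp
    with 0 assms(1) show "v = 0" by (simp add: vec_eq_iff forall_2 rotating_coord_def)
  qed
  from linear_inj_bounded_below_pos[OF lin this] obtain B where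
    B: "B > 0" "\<And>v. B * norm v \<le> cmod (rotating_coord M t v)" by metis
  show ?thesis
    by (rule that[of "1 / B"]) (use B in \<open>auto simp: field_simps\<close>)
qed

lemma square_decay_in_l2:
  assumes "\<And>n. n \<ge> 1 \<Longrightarrow> (u n)\<^sup>2 \<le> C / (real n)\<^sup>2"
  shows "u \<in> l2_real"
proof -
  have "summable (\<lambda>n. C * inverse ((real n)\<^sup>2))"
    by (intro summable_mult inverse_power_summable) auto
  then have "summable (\<lambda>n. norm ((u n)\<^sup>2))"
  proof (rule summable_comparison_test[rotated], intro exI allI impI)
    fix n :: nat assume "n \<ge> 1"
    then show "norm (norm ((u n)\<^sup>2)) \<le> C * inverse ((real n)\<^sup>2)"
      using assms[of n] by (simp add: divide_inverse)
  qed
  then have "(\<lambda>n. (u n)\<^sup>2) summable_on UNIV" by (rule norm_summable_imp_summable_on)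
  then show ?thesis
    unfolding l2_real_def using summable_on_subset_banach by blast
qed

lemma transfer_products_bounded:
  obtains D where "D \<ge> 0" "\<And>m v. m \<le> T \<Longrightarrow> norm (transfer_product T a b x m *v v) \<le> D * norm v"
proof -
  define D where "D = (\<Sum>m\<le>T. onorm ((*v) (transfer_product T a b x m)))"
  have on: "onorm ((*v) (transfer_product T a b x m)) \<ge> 0" for m
    by (intro onorm_pos_le matrix_vector_mul_bounded_linear)
  show ?thesis
  proof (rule that[of D])
    show "D \<ge> 0" unfolding D_def by (intro sum_nonneg on)
    fix m v assume "m \<le> T"
    then have "onorm ((*v) (transfer_product T a b x m)) \<le> D"
      unfolding D_def using on by (intro member_le_sum) auto
    then show "norm (transfer_product T a b x m *v v) \<le> D * norm v"
      by (meson matrix_vector_mul_bounded_linear mult_right_mono norm_ge_zero onorm order_trans)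
  qed
qed

text \<open>In the rotating coordinate each period is a kick followed by a rotation, and the coordinate controls the
  solution. The bound uses the coordinate at the end of the period because the sheared vector, which generates
  all entries of the period, has a coordinate of the same modulus; so no bound on \<open>q\<close>
  enters the constant.\<close>

lemma elliptic_solution_dynamics:
  assumes per: "period_jacobi T a b" and x: "x \<in> sigma_ell T a b"
    and sol: "\<And>n. n \<ge> 1 \<Longrightarrow> jacobi_op a b u n + q n * u n = x * u n" and u0: "u 0 = 0"
    and q0: "\<And>k m. 2 \<le> m \<Longrightarrow> m \<le> T \<Longrightarrow> q (k * T + m) = 0"
  defines "M \<equiv> monodromy T a b x" and "t \<equiv> quasi_momentum T a b x"
  defines "z \<equiv> \<lambda>k. rotating_coord M t (vector [u (k * T), u (k * T + 1)])"
  shows "z (Suc k) = cis t * kick (q (k * T + 1) * (M $ 2 $ 1 / (a T * sin t))) (z k)"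
    and "\<exists>E. \<forall>k. \<forall>m\<in>{1..T}. (u (k * T + m))\<^sup>2 \<le> E * (cmod (z (Suc k)))\<^sup>2"
proof -
  have T: "T \<ge> 1" using per by (simp add: period_jacobi_def)
  have det: "det M = 1" using det_monodromy[OF per] by (simp add: M_def)
  have tr: "trace M = 2 * cos t" and t: "0 < t" "t < pi"
    using quasi_momentum[OF per x] by (auto simp: M_def t_def)
  have "\<bar>trace M\<bar> < 2" using x by (simp add: sigma_ell_def M_def)
  with det have M21: "M $ 2 $ 1 \<noteq> 0" by (rule elliptic_lower_left_nonzero)
  have sin: "sin t \<noteq> 0" using sin_gt_zero[OF t] by simp
  define v where "v k = (vector [u (k * T) + q (k * T + 1) / a T * u (k * T + 1), u (k * T + 1)] :: real^2)"
    for k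
  have propag: "transfer_product T a b x m *v v k = vector [u (k * T + m), u (k * T + Suc m)]"
    if "1 \<le> m" "m \<le> T" for m k
    unfolding v_def using period_propagates[OF per sol u0 q0 that] .
  have zS: "z (Suc k) = cis t * rotating_coord M t (v k)" for k
  proof -
    have "z (Suc k) = rotating_coord M t (M *v v k)"
      using propag[OF T order_refl, of k] by (simp add: z_def M_def monodromy_def add.commute)
    then show ?thesis by (simp add: rotating_coord_mult[OF det tr])
  qed
  have "rotating_coord M t (v k) = kick (q (k * T + 1) / a T * (M $ 2 $ 1 / sin t)) (z k)"
    using rotating_coord_shear[OF sin, of M "vector [u (k * T), u (k * T + 1)]" "q (k * T + 1) / a T"]
    by (simp add: v_def z_def)
  then show "z (Suc k) = cis t * kick (q (k * T + 1) * (M $ 2 $ 1 / (a T * sin t))) (z k)"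
    by (simp add: zS)
  obtain B where B: "B > 0" "\<And>v. norm v \<le> B * cmod (rotating_coord M t v)"
    using norm_le_rotating_coord[OF M21 sin] by blast
  obtain D where D: "D \<ge> 0" "\<And>m v. m \<le> T \<Longrightarrow> norm (transfer_product T a b x m *v v) \<le> D * norm v"
    using transfer_products_bounded by blast
  have "(u (k * T + m))\<^sup>2 \<le> (D * B)\<^sup>2 * (cmod (z (Suc k)))\<^sup>2" if m: "m \<in> {1..T}" for k m
  proof -
    have "\<bar>u (k * T + m)\<bar> = \<bar>(transfer_product T a b x m *v v k) $ 1\<bar>"
      using propag[of m k] m by simp
    also have "\<dots> \<le> norm (transfer_product T a b x m *v v k)" by (rule component_le_norm_cart)
    also have "\<dots> \<le> D * norm (v k)" using D(2) m by simp
    also have "\<dots> \<le> D * (B * cmod (rotating_coord M t (v k)))"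
      using B(2) D(1) by (intro mult_left_mono)
    also have "\<dots> = D * B * cmod (z (Suc k))" by (simp add: zS norm_mult)
    finally have "\<bar>u (k * T + m)\<bar>\<^sup>2 \<le> (D * B * cmod (z (Suc k)))\<^sup>2" by (intro power_mono) auto
    then show ?thesis by (simp add: power_mult_distrib)
  qed
  then show "\<exists>E. \<forall>k. \<forall>m\<in>{1..T}. (u (k * T + m))\<^sup>2 \<le> E * (cmod (z (Suc k)))\<^sup>2" by blast
qed

section \<open>Embedded eigenvalues\<close>

theorem theorem3p3:
  fixes T :: nat and a b lam K :: "nat \<Rightarrow> real"
  assumes "period_jacobi T a b"
    and "\<And>i. i \<ge> 1 \<Longrightarrow> lam i \<in> sigma_ell T a b"
    and "\<And>k. k \<ge> 1 \<Longrightarrow>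
           rationally_independent {0..k} (\<lambda>i. if i = 0 then pi else quasi_momentum T a b (lam i))"
    and "\<And>n. n \<ge> 1 \<Longrightarrow> K n > 0"
    and "filterlim K at_top sequentially"
  shows "\<exists>q :: nat \<Rightarrow> real.
           (\<forall>n\<ge>1. \<bar>q n\<bar> \<le> K n / real n) \<and>
           (\<forall>i\<ge>1. \<exists>u\<in>l2_real. (\<exists>n\<ge>1. u n \<noteq> 0) \<and>
              (\<forall>n\<ge>1. jacobi_op a b u n + diag_op q u n = lam i * u n))"
proof -
  note per = assms(1)
  have T: "T \<ge> 1" and a_pos: "\<And>n. n \<ge> 1 \<Longrightarrow> a n > 0"
    using per by (auto simp: period_jacobi_def)
  define \<theta> where "\<theta> i = quasi_momentum T a b (lam i)" for i
  define M where "M i = monodromy T a b (lam i)" for i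
  define c where "c i = M i $ 2 $ 1 / (a T * sin (\<theta> i))" for i
  define \<delta> where "\<delta> k = K (k * T + 1) / real (k * T + 1)" for k
  have c: "c i \<noteq> 0" if "i \<ge> 1" for i
  proof -
    note x = assms(2)[OF that]
    have "sin (\<theta> i) > 0"
      using quasi_momentum(1)[OF per x] by (intro sin_gt_zero) (auto simp: \<theta>_def)
    moreover have "M i $ 2 $ 1 \<noteq> 0"
      unfolding M_def using x det_monodromy[OF per]
      by (intro elliptic_lower_left_nonzero) (auto simp: sigma_ell_def)
    ultimately show ?thesis using a_pos[OF T] by (simp add: c_def)
  qed
  have \<delta>: "\<delta> k > 0" for k
    unfolding \<delta>_def by (intro divide_pos_pos assms(4)) (simp_all del: of_nat_add of_nat_mult of_nat_Suc)
  have "strict_mono (\<lambda>k. k * T + 1)" using T by (auto simp: strict_mono_def)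
  then have "filterlim (\<lambda>k. K (k * T + 1)) at_top sequentially"
    by (intro filterlim_compose[OF assms(5)] filterlim_subseq)
  then have "filterlim (\<lambda>k. 1 / (2 * real T) * K (k * T + 1)) at_top sequentially"
    using T by (intro filterlim_tendsto_pos_mult_at_top[OF tendsto_const]) auto
  then have \<delta>_lim: "filterlim (\<lambda>k. real k * \<delta> k) at_top sequentially"
  proof (rule filterlim_at_top_mono)
    have "1 / (2 * real T) * K (k * T + 1) \<le> real k * \<delta> k" if "k \<ge> 1" for k
    proof -
      have "k * T \<ge> 1" using that T by simp
      then have "real (k * T + 1) \<le> real (k * (2 * T))" by (subst of_nat_le_iff) linarith
      then have "1 / (2 * real T) \<le> real k / real (k * T + 1)"
        using T by (simp add: field_simps)
      then have "1 / (2 * real T) * K (k * T + 1) \<le> real k / real (k * T + 1) * K (k * T + 1)"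
        using assms(4)[of "k * T + 1"] by (intro mult_right_mono) auto
      then show ?thesis by (simp add: \<delta>_def)
    qed
    then show "\<forall>\<^sub>F k in sequentially. 1 / (2 * real T) * K (k * T + 1) \<le> real k * \<delta> k"
      using eventually_sequentially by blast
  qed
  have ind: "rationally_independent {0..j} (\<lambda>i. if i = 0 then pi else \<theta> i)" if "j \<ge> 1" for j
    unfolding \<theta>_def using assms(3)[OF that] .
  obtain p Z where p: "\<forall>k. \<bar>p k\<bar> \<le> \<delta> k"
    and Z0: "\<forall>i. Z 0 i = rotating_coord (M i) (\<theta> i) (vector [0, 1])"
    and ZS: "\<forall>k i. Z (Suc k) i = cis (\<theta> i) * kick (p k * c i) (Z k i)"
    and decay: "\<forall>i\<ge>1. \<exists>C. \<forall>k\<ge>1. (cmod (Z k i))\<^sup>2 \<le> C / (real k)\<^sup>2"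
    using common_decay[of \<theta> c \<delta> "\<lambda>i. rotating_coord (M i) (\<theta> i) (vector [0, 1])",
        OF ind c \<delta> \<delta>_lim] by blast
  define q where "q n = (if (n - 1) mod T = 0 then p ((n - 1) div T) else 0)" for n
  have q1: "q (k * T + 1) = p k" for k using T by (simp add: q_def)
  have q0: "q (k * T + m) = 0" if "2 \<le> m" "m \<le> T" for k m
  proof -
    have "k * T + m - 1 = (m - 1) + k * T" using that by linarith
    then have "(k * T + m - 1) mod T = (m - 1) mod T" by (simp only: mod_mult_self1)
    also have "\<dots> = m - 1" using that by (intro mod_less) linarith
    finally show ?thesis using that by (simp add: q_def)
  qed
  have split: "\<exists>k. \<exists>m\<in>{1..T}. n = k * T + m" if "n \<ge> 1" for n
  proof (intro exI bexI)
    show "n = (n - 1) div T * T + Suc ((n - 1) mod T)" using that by simp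
    show "Suc ((n - 1) mod T) \<in> {1..T}" using T by (simp add: Suc_le_eq)
  qed
  have "\<bar>q n\<bar> \<le> K n / real n" if "n \<ge> 1" for n
  proof -
    obtain k m where m: "m \<in> {1..T}" "n = k * T + m" using split[OF \<open>n \<ge> 1\<close>] by blast
    show ?thesis
    proof (cases "m = 1")
      case True
      then show ?thesis using p[rule_format, of k] q1[of k] by (simp add: m(2) \<delta>_def)
    next
      case False
      then show ?thesis using q0[of m k] m assms(4)[OF that] by simp
    qed
  qed
  moreover have "\<exists>u\<in>l2_real. (\<exists>n\<ge>1. u n \<noteq> 0) \<and>
      (\<forall>n\<ge>1. jacobi_op a b u n + diag_op q u n = lam i * u n)" if i: "i \<ge> 1" for i
  proof -
    define u where "u = jacobi_solution a (\<lambda>n. b n + q n) (lam i)"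
    have sol: "jacobi_op a b u n + q n * u n = lam i * u n" if "n \<ge> 1" for n
    proof -
      have "jacobi_op a b u n + q n * u n = jacobi_op a (\<lambda>n. b n + q n) u n"
        by (simp add: jacobi_op_def algebra_simps)
      also have "\<dots> = lam i * u n"
        unfolding u_def using that a_pos[OF that] by (intro jacobi_op_jacobi_solution) auto
      finally show ?thesis .
    qed
    have u0: "u 0 = 0" and u1: "u 1 = 1" by (simp_all add: u_def)
    note dyn = elliptic_solution_dynamics[OF per assms(2)[OF i] sol u0 q0, folded \<theta>_def M_def]
    have Z: "Z k i = rotating_coord (M i) (\<theta> i) (vector [u (k * T), u (k * T + 1)])" for k
    proof (induction k)
      case 0
      then show ?case using u0 u1 by (simp add: Z0)
    next
      case (Suc k)
      then show ?case using dyn(1)[of k] q1[of k] by (simp add: ZS c_def)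
    qed
    obtain E where E: "\<And>k m. m \<in> {1..T} \<Longrightarrow> (u (k * T + m))\<^sup>2 \<le> E * (cmod (Z (Suc k) i))\<^sup>2"
      using dyn(2) unfolding Z[symmetric] by blast
    obtain C where C: "\<And>k. k \<ge> 1 \<Longrightarrow> (cmod (Z k i))\<^sup>2 \<le> C / (real k)\<^sup>2"
      using decay i by blast
    have C0: "C \<ge> 0" using order_trans[OF zero_le_power2 C[of 1]] by simp
    have "(u n)\<^sup>2 \<le> (\<bar>E\<bar> * C * (real T)\<^sup>2) / (real n)\<^sup>2" if "n \<ge> 1" for n
    proof -
      obtain k m where m: "m \<in> {1..T}" "n = k * T + m" using split[OF \<open>n \<ge> 1\<close>] by blast
      have "(u n)\<^sup>2 \<le> E * (cmod (Z (Suc k) i))\<^sup>2" using E m by simp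
      also have "\<dots> \<le> \<bar>E\<bar> * (C / (real (Suc k))\<^sup>2)"
        using C[of "Suc k"] by (intro mult_mono) auto
      also have "C / (real (Suc k))\<^sup>2 \<le> C * (real T)\<^sup>2 / (real n)\<^sup>2"
      proof -
        have "real n \<le> real (Suc k * T)" using m by (subst of_nat_le_iff) simp
        then have "(real n)\<^sup>2 \<le> (real (Suc k))\<^sup>2 * (real T)\<^sup>2"
          by (metis of_nat_0_le_iff of_nat_mult power_mono power_mult_distrib)
        then have "C * (real n)\<^sup>2 \<le> C * ((real (Suc k))\<^sup>2 * (real T)\<^sup>2)"
          using C0 by (intro mult_left_mono)
        then show ?thesis using that by (simp add: divide_simps mult_ac del: of_nat_Suc)
      qed
      finally show ?thesis by (simp add: mult_left_mono mult.assoc)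
    qed
    then have "u \<in> l2_real" by (rule square_decay_in_l2)
    then show ?thesis using sol u1 by (intro bexI[of _ u]) (auto simp: diag_op_def intro: exI[of _ 1])
  qed
  ultimately show ?thesis by blast
qed

end
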